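(* Let $\mathcal{L}_A^+$ be an extension of the language of arithmetic $\mathcal{L}_A$ by finitely many predicate and function symbols (of any finite arities). Then there is no arithmetically definable Gaifman-Snir probability function on $\mathcal{L}_A^+$.
   Context: $\mathcal{L}_A$ is the first-order language of arithmetic with symbols $0, S, +, \times, x^y, <$; for $n\in\omega$, $\underline{n} := S^n(0)$ is the $n$-th numeral. $\mathcal{L}_A^+ \supseteq \mathcal{L}_A$ is obtained by adding finitely many "empirical" predicate or function symbols of finite arity. $\mathcal{SL}_A$, $\mathcal{SL}_A^+$ denote the sets of sentences of $\mathcal{L}_A$, $\mathcal{L}_A^+$. $\mathbb{N}$ is the standard model of arithmetic with domain $\omega$. $Mod(\mathcal{L}_A^+)$ denotes the set of all $\mathcal{L}_A^+$-structures whose domain is $\omega$ and in which every symbol of $\mathcal{L}_A$ has its standard interpretation, i.e. all expansions of $\mathbb{N}$ to $\mathcal{L}_A^+$. $Mod(\mathcal{L}_A^+)\vDash\varphi$ means $\mathcal{M}\vDash\varphi$ for all $\mathcal{M}\in Mod(\mathcal{L}_A^+)$. A Gaifman-Snir probability function on $\mathcal{L}_A^+$ is a function $P:\mathcal{SL}_A^+\to[0,1]$ such that: (G1) if $Mod(\mathcal{L}_A^+)\vDash\varphi$ then $P(\varphi)=1$; (G2) if $Mod(\mathcal{L}_A^+)\vDash\neg(\varphi\land\psi)$ then $P(\varphi\lor\psi)=P(\varphi)+P(\psi)$; (G3) $P(\exists x\,\psi(x))=\sup\{P(\bigvee_{i<n}\psi(\underline{i}))\mid n\in\omega\}$ for every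 sentence $\exists x\,\psi(x)$. Definability: Fix a standard Gödel numbering $\ulcorner\cdot\urcorner$ of formulas, and identify $P$ with the function $\ulcorner\varphi\urcorner\mapsto P(\varphi)$ on codes of sentences. Rationals are coded in arithmetic in the standard way. A rational-valued function $g$ is defined by an $\mathcal{L}_A$-formula $\varphi$ if $g(\vec x)=y\leftrightarrow\varphi(\vec x,y)$ and $\mathsf{PA}$ proves that for all arguments $\vec x$ in the domain there is a unique $y$ with $\varphi(\vec x,y)$. A rational-valued function $g$ is an approximation for a real-valued function $f$ if $\mathrm{dom}(g)=\mathrm{dom}(f)\times\omega$ and $|f(\vec x)-g(\vec x,n)|\le 2^{-n}$ for all $\vec x\in\mathrm{dom}(f)$, $n\in\omega$. A real-valued function $f$ is arithmetically definable if it has an approximation defined by some $\mathcal{L}_A$-formula. *)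

theory Defs
  imports Complex_Main "HOL-Library.Nat_Bijection"
begin

section \<open>Syntax\<close>

text \<open>
  Formulas use de Bruijn indices. The symbols \<open>Fn f\<close> and \<open>Rl p\<close> are the extra
  (``empirical'') symbols. A signature extending the language of arithmetic is a pair of lists
  \<open>fs\<close>, \<open>rs\<close> of arities: its extra function symbols are \<open>Fn f\<close> for \<open>f < length fs\<close>, of arity
  \<open>fs ! f\<close>, and its extra predicate symbols are \<open>Rl p\<close> for \<open>p < length rs\<close>, of arity \<open>rs ! p\<close>.
  The language of arithmetic itself is the signature \<open>[]\<close>, \<open>[]\<close>.
\<close>

datatype tm = Var nat | Zero | Succ tm | Add tm tm | Mul tm tm | Expo tm tm | Fn nat "tm list"

datatype fm = Eq tm tm | Less tm tm | Rl nat "tm list"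
  | Fls | Neg fm | And fm fm | Or fm fm | Imp fm fm | All fm | Exi fm

definition Iff :: "fm \<Rightarrow> fm \<Rightarrow> fm" where
  "Iff \<phi> \<psi> = And (Imp \<phi> \<psi>) (Imp \<psi> \<phi>)"

fun lang_tm :: "nat list \<Rightarrow> tm \<Rightarrow> bool" where
  "lang_tm fs (Var i) = True"
| "lang_tm fs Zero = True"
| "lang_tm fs (Succ t) = lang_tm fs t"
| "lang_tm fs (Add s t) = (lang_tm fs s \<and> lang_tm fs t)"
| "lang_tm fs (Mul s t) = (lang_tm fs s \<and> lang_tm fs t)"
| "lang_tm fs (Expo s t) = (lang_tm fs s \<and> lang_tm fs t)"
| "lang_tm fs (Fn f ts) = (f < length fs \<and> length ts = fs ! f \<and> (\<forall>t\<in>set ts. lang_tm fs t))"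

fun lang_fm :: "nat list \<Rightarrow> nat list \<Rightarrow> fm \<Rightarrow> bool" where
  "lang_fm fs rs (Eq s t) = (lang_tm fs s \<and> lang_tm fs t)"
| "lang_fm fs rs (Less s t) = (lang_tm fs s \<and> lang_tm fs t)"
| "lang_fm fs rs (Rl p ts) = (p < length rs \<and> length ts = rs ! p \<and> (\<forall>t\<in>set ts. lang_tm fs t))"
| "lang_fm fs rs Fls = True"
| "lang_fm fs rs (Neg \<phi>) = lang_fm fs rs \<phi>"
| "lang_fm fs rs (And \<phi> \<psi>) = (lang_fm fs rs \<phi> \<and> lang_fm fs rs \<psi>)"
| "lang_fm fs rs (Or \<phi> \<psi>) = (lang_fm fs rs \<phi> \<and> lang_fm fs rs \<psi>)"
| "lang_fm fs rs (Imp \<phi> \<psi>) = (lang_fm fs rs \<phi> \<and> lang_fm fs rs \<psi>)"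
| "lang_fm fs rs (All \<phi>) = lang_fm fs rs \<phi>"
| "lang_fm fs rs (Exi \<phi>) = lang_fm fs rs \<phi>"

text \<open>All free indices are below \<open>k\<close>.\<close>

fun below_tm :: "nat \<Rightarrow> tm \<Rightarrow> bool" where
  "below_tm k (Var i) = (i < k)"
| "below_tm k Zero = True"
| "below_tm k (Succ t) = below_tm k t"
| "below_tm k (Add s t) = (below_tm k s \<and> below_tm k t)"
| "below_tm k (Mul s t) = (below_tm k s \<and> below_tm k t)"
| "below_tm k (Expo s t) = (below_tm k s \<and> below_tm k t)"
| "below_tm k (Fn f ts) = (\<forall>t\<in>set ts. below_tm k t)"

fun below_fm :: "nat \<Rightarrow> fm \<Rightarrow> bool" where
  "below_fm k (Eq s t) = (below_tm k s \<and> below_tm k t)"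
| "below_fm k (Less s t) = (below_tm k s \<and> below_tm k t)"
| "below_fm k (Rl p ts) = (\<forall>t\<in>set ts. below_tm k t)"
| "below_fm k Fls = True"
| "below_fm k (Neg \<phi>) = below_fm k \<phi>"
| "below_fm k (And \<phi> \<psi>) = (below_fm k \<phi> \<and> below_fm k \<psi>)"
| "below_fm k (Or \<phi> \<psi>) = (below_fm k \<phi> \<and> below_fm k \<psi>)"
| "below_fm k (Imp \<phi> \<psi>) = (below_fm k \<phi> \<and> below_fm k \<psi>)"
| "below_fm k (All \<phi>) = below_fm (Suc k) \<phi>"
| "below_fm k (Exi \<phi>) = below_fm (Suc k) \<phi>"

definition sentence :: "nat list \<Rightarrow> nat list \<Rightarrow> fm \<Rightarrow> bool" where
  "sentence fs rs \<phi> \<longleftrightarrow> lang_fm fs rs \<phi> \<and> below_fm 0 \<phi>"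

text \<open>Lifting of the free indices from \<open>n\<close> on, and substitution for index \<open>n\<close> (removing it).\<close>

fun lift_tm :: "nat \<Rightarrow> tm \<Rightarrow> tm" where
  "lift_tm n (Var i) = Var (if i < n then i else Suc i)"
| "lift_tm n Zero = Zero"
| "lift_tm n (Succ t) = Succ (lift_tm n t)"
| "lift_tm n (Add s t) = Add (lift_tm n s) (lift_tm n t)"
| "lift_tm n (Mul s t) = Mul (lift_tm n s) (lift_tm n t)"
| "lift_tm n (Expo s t) = Expo (lift_tm n s) (lift_tm n t)"
| "lift_tm n (Fn f ts) = Fn f (map (lift_tm n) ts)"

fun lift_fm :: "nat \<Rightarrow> fm \<Rightarrow> fm" where
  "lift_fm n (Eq s t) = Eq (lift_tm n s) (lift_tm n t)"
| "lift_fm n (Less s t) = Less (lift_tm n s) (lift_tm n t)"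
| "lift_fm n (Rl p ts) = Rl p (map (lift_tm n) ts)"
| "lift_fm n Fls = Fls"
| "lift_fm n (Neg \<phi>) = Neg (lift_fm n \<phi>)"
| "lift_fm n (And \<phi> \<psi>) = And (lift_fm n \<phi>) (lift_fm n \<psi>)"
| "lift_fm n (Or \<phi> \<psi>) = Or (lift_fm n \<phi>) (lift_fm n \<psi>)"
| "lift_fm n (Imp \<phi> \<psi>) = Imp (lift_fm n \<phi>) (lift_fm n \<psi>)"
| "lift_fm n (All \<phi>) = All (lift_fm (Suc n) \<phi>)"
| "lift_fm n (Exi \<phi>) = Exi (lift_fm (Suc n) \<phi>)"

fun subst_tm :: "nat \<Rightarrow> tm \<Rightarrow> tm \<Rightarrow> tm" where
  "subst_tm n u (Var i) = (if i < n then Var i else if i = n then u else Var (i - 1))"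
| "subst_tm n u Zero = Zero"
| "subst_tm n u (Succ t) = Succ (subst_tm n u t)"
| "subst_tm n u (Add s t) = Add (subst_tm n u s) (subst_tm n u t)"
| "subst_tm n u (Mul s t) = Mul (subst_tm n u s) (subst_tm n u t)"
| "subst_tm n u (Expo s t) = Expo (subst_tm n u s) (subst_tm n u t)"
| "subst_tm n u (Fn f ts) = Fn f (map (subst_tm n u) ts)"

fun subst_fm :: "nat \<Rightarrow> tm \<Rightarrow> fm \<Rightarrow> fm" where
  "subst_fm n u (Eq s t) = Eq (subst_tm n u s) (subst_tm n u t)"
| "subst_fm n u (Less s t) = Less (subst_tm n u s) (subst_tm n u t)"
| "subst_fm n u (Rl p ts) = Rl p (map (subst_tm n u) ts)"
| "subst_fm n u Fls = Fls"
| "subst_fm n u (Neg \<phi>) = Neg (subst_fm n u \<phi>)"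
| "subst_fm n u (And \<phi> \<psi>) = And (subst_fm n u \<phi>) (subst_fm n u \<psi>)"
| "subst_fm n u (Or \<phi> \<psi>) = Or (subst_fm n u \<phi>) (subst_fm n u \<psi>)"
| "subst_fm n u (Imp \<phi> \<psi>) = Imp (subst_fm n u \<phi>) (subst_fm n u \<psi>)"
| "subst_fm n u (All \<phi>) = All (subst_fm (Suc n) (lift_tm 0 u) \<phi>)"
| "subst_fm n u (Exi \<phi>) = Exi (subst_fm (Suc n) (lift_tm 0 u) \<phi>)"

definition num :: "nat \<Rightarrow> tm" where
  "num n = (Succ ^^ n) Zero"

definition Alls :: "nat \<Rightarrow> fm \<Rightarrow> fm" where
  "Alls k \<phi> = (All ^^ k) \<phi>"

definition Ors :: "fm list \<Rightarrow> fm" where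
  "Ors \<phi>s = foldr Or \<phi>s Fls"

definition Ex1 :: "fm \<Rightarrow> fm" where
  "Ex1 \<phi> = Exi (All (Iff (lift_fm 1 \<phi>) (Eq (Var 0) (Var 1))))"


section \<open>Expansions of the standard model\<close>

text \<open>
  An expansion of the standard model interprets the extra function and predicate symbols; its
  values at undeclared symbols and at argument lists of the wrong length are irrelevant.
\<close>

type_synonym expansion = "(nat \<Rightarrow> nat list \<Rightarrow> nat) \<times> (nat \<Rightarrow> nat list \<Rightarrow> bool)"

fun eval :: "expansion \<Rightarrow> (nat \<Rightarrow> nat) \<Rightarrow> tm \<Rightarrow> nat" where
  "eval M e (Var i) = e i"
| "eval M e Zero = 0"
| "eval M e (Succ t) = Suc (eval M e t)"
| "eval M e (Add s t) = eval M e s + eval M e t"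
| "eval M e (Mul s t) = eval M e s * eval M e t"
| "eval M e (Expo s t) = eval M e s ^ eval M e t"
| "eval M e (Fn f ts) = fst M f (map (eval M e) ts)"

fun sat :: "expansion \<Rightarrow> (nat \<Rightarrow> nat) \<Rightarrow> fm \<Rightarrow> bool" where
  "sat M e (Eq s t) = (eval M e s = eval M e t)"
| "sat M e (Less s t) = (eval M e s < eval M e t)"
| "sat M e (Rl p ts) = snd M p (map (eval M e) ts)"
| "sat M e Fls = False"
| "sat M e (Neg \<phi>) = (\<not> sat M e \<phi>)"
| "sat M e (And \<phi> \<psi>) = (sat M e \<phi> \<and> sat M e \<psi>)"
| "sat M e (Or \<phi> \<psi>) = (sat M e \<phi> \<or> sat M e \<psi>)"
| "sat M e (Imp \<phi> \<psi>) = (sat M e \<phi> \<longrightarrow> sat M e \<psi>)"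
| "sat M e (All \<phi>) = (\<forall>x. sat M (case_nat x e) \<phi>)"
| "sat M e (Exi \<phi>) = (\<exists>x. sat M (case_nat x e) \<phi>)"

text \<open>Assignment giving index \<open>i\<close> the value \<open>xs ! i\<close>.\<close>

definition env :: "nat list \<Rightarrow> nat \<Rightarrow> nat" where
  "env xs i = (if i < length xs then xs ! i else 0)"

definition models :: "expansion \<Rightarrow> fm \<Rightarrow> bool" where
  "models M \<phi> \<longleftrightarrow> sat M (env []) \<phi>"

definition valid :: "fm \<Rightarrow> bool" where
  "valid \<phi> \<longleftrightarrow> (\<forall>M. models M \<phi>)"

text \<open>
  Truth in the standard model, for formulas without extra symbols (how the extra symbols are
  interpreted then does not matter).
\<close>

definition sat_N :: "nat list \<Rightarrow> fm \<Rightarrow> bool" where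
  "sat_N xs \<phi> \<longleftrightarrow> sat (\<lambda>f as. 0, \<lambda>p as. False) (env xs) \<phi>"


section \<open>Gaifman-Snir probability functions\<close>

definition Or_upto :: "nat \<Rightarrow> fm \<Rightarrow> fm" where
  "Or_upto n \<psi> = Ors (map (\<lambda>i. subst_fm 0 (num i) \<psi>) [0..<n])"

definition gaifman_snir :: "nat list \<Rightarrow> nat list \<Rightarrow> (fm \<Rightarrow> real) \<Rightarrow> bool" where
  "gaifman_snir fs rs P \<longleftrightarrow>
     (\<forall>\<phi>. sentence fs rs \<phi> \<longrightarrow> 0 \<le> P \<phi> \<and> P \<phi> \<le> 1) \<and>
     (\<forall>\<phi>. sentence fs rs \<phi> \<longrightarrow> valid \<phi> \<longrightarrow> P \<phi> = 1) \<and>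
     (\<forall>\<phi> \<psi>. sentence fs rs \<phi> \<longrightarrow> sentence fs rs \<psi> \<longrightarrow> valid (Neg (And \<phi> \<psi>)) \<longrightarrow>
        P (Or \<phi> \<psi>) = P \<phi> + P \<psi>) \<and>
     (\<forall>\<psi>. sentence fs rs (Exi \<psi>) \<longrightarrow> P (Exi \<psi>) = (SUP n. P (Or_upto n \<psi>)))"


section \<open>Peano arithmetic\<close>

text \<open>
  Natural deduction in the language of arithmetic. The rules that bring in an arbitrary term or
  formula require it to belong to that language.
\<close>

abbreviation arith_tm :: "tm \<Rightarrow> bool" where
  "arith_tm \<equiv> lang_tm []"

abbreviation arith_fm :: "fm \<Rightarrow> bool" where
  "arith_fm \<equiv> lang_fm [] []"

inductive derives :: "fm set \<Rightarrow> fm \<Rightarrow> bool" (infix "\<turnstile>" 50) where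
  Assm: "\<phi> \<in> \<Gamma> \<Longrightarrow> \<Gamma> \<turnstile> \<phi>"
| FlsE: "\<Gamma> \<turnstile> Fls \<Longrightarrow> arith_fm \<phi> \<Longrightarrow> \<Gamma> \<turnstile> \<phi>"
| Class: "arith_fm \<phi> \<Longrightarrow> insert (Neg \<phi>) \<Gamma> \<turnstile> Fls \<Longrightarrow> \<Gamma> \<turnstile> \<phi>"
| NegI: "arith_fm \<phi> \<Longrightarrow> insert \<phi> \<Gamma> \<turnstile> Fls \<Longrightarrow> \<Gamma> \<turnstile> Neg \<phi>"
| NegE: "\<Gamma> \<turnstile> Neg \<phi> \<Longrightarrow> \<Gamma> \<turnstile> \<phi> \<Longrightarrow> \<Gamma> \<turnstile> Fls"
| AndI: "\<Gamma> \<turnstile> \<phi> \<Longrightarrow> \<Gamma> \<turnstile> \<psi> \<Longrightarrow> \<Gamma> \<turnstile> And \<phi> \<psi>"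
| AndE1: "\<Gamma> \<turnstile> And \<phi> \<psi> \<Longrightarrow> \<Gamma> \<turnstile> \<phi>"
| AndE2: "\<Gamma> \<turnstile> And \<phi> \<psi> \<Longrightarrow> \<Gamma> \<turnstile> \<psi>"
| OrI1: "\<Gamma> \<turnstile> \<phi> \<Longrightarrow> arith_fm \<psi> \<Longrightarrow> \<Gamma> \<turnstile> Or \<phi> \<psi>"
| OrI2: "\<Gamma> \<turnstile> \<psi> \<Longrightarrow> arith_fm \<phi> \<Longrightarrow> \<Gamma> \<turnstile> Or \<phi> \<psi>"
| OrE: "\<Gamma> \<turnstile> Or \<phi> \<psi> \<Longrightarrow> insert \<phi> \<Gamma> \<turnstile> \<chi> \<Longrightarrow> insert \<psi> \<Gamma> \<turnstile> \<chi> \<Longrightarrow> \<Gamma> \<turnstile> \<chi>"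
| ImpI: "arith_fm \<phi> \<Longrightarrow> insert \<phi> \<Gamma> \<turnstile> \<psi> \<Longrightarrow> \<Gamma> \<turnstile> Imp \<phi> \<psi>"
| ImpE: "\<Gamma> \<turnstile> Imp \<phi> \<psi> \<Longrightarrow> \<Gamma> \<turnstile> \<phi> \<Longrightarrow> \<Gamma> \<turnstile> \<psi>"
| AllI: "lift_fm 0 ` \<Gamma> \<turnstile> \<phi> \<Longrightarrow> \<Gamma> \<turnstile> All \<phi>"
| AllE: "\<Gamma> \<turnstile> All \<phi> \<Longrightarrow> arith_tm t \<Longrightarrow> \<Gamma> \<turnstile> subst_fm 0 t \<phi>"
| ExiI: "\<Gamma> \<turnstile> subst_fm 0 t \<phi> \<Longrightarrow> \<Gamma> \<turnstile> Exi \<phi>"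
| ExiE: "\<Gamma> \<turnstile> Exi \<phi> \<Longrightarrow> insert \<phi> (lift_fm 0 ` \<Gamma>) \<turnstile> lift_fm 0 \<chi> \<Longrightarrow> \<Gamma> \<turnstile> \<chi>"
| EqI: "arith_tm t \<Longrightarrow> \<Gamma> \<turnstile> Eq t t"
| EqE: "\<Gamma> \<turnstile> Eq s t \<Longrightarrow> \<Gamma> \<turnstile> subst_fm 0 s \<phi> \<Longrightarrow> \<Gamma> \<turnstile> subst_fm 0 t \<phi>"

text \<open>
  In \<open>Induction\<close> the induction variable is index 0 and the parameters are the indices \<open>1..k\<close>;
  \<open>subst_fm 0 (Succ (Var 0)) (lift_fm 1 \<phi>)\<close> replaces index 0 by its successor.
\<close>

inductive_set PA :: "fm set" where
  Succ_not_zero: "All (Neg (Eq (Succ (Var 0)) Zero)) \<in> PA"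
| Succ_inject: "All (All (Imp (Eq (Succ (Var 0)) (Succ (Var 1))) (Eq (Var 0) (Var 1)))) \<in> PA"
| Add_zero: "All (Eq (Add (Var 0) Zero) (Var 0)) \<in> PA"
| Add_succ: "All (All (Eq (Add (Var 0) (Succ (Var 1))) (Succ (Add (Var 0) (Var 1))))) \<in> PA"
| Mul_zero: "All (Eq (Mul (Var 0) Zero) Zero) \<in> PA"
| Mul_succ: "All (All (Eq (Mul (Var 0) (Succ (Var 1))) (Add (Mul (Var 0) (Var 1)) (Var 0)))) \<in> PA"
| Expo_zero: "All (Eq (Expo (Var 0) Zero) (Succ Zero)) \<in> PA"
| Expo_succ: "All (All (Eq (Expo (Var 0) (Succ (Var 1))) (Mul (Expo (Var 0) (Var 1)) (Var 0)))) \<in> PA"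
| Less_zero: "All (Neg (Less (Var 0) Zero)) \<in> PA"
| Less_succ: "All (All (Iff (Less (Var 0) (Succ (Var 1)))
    (Or (Less (Var 0) (Var 1)) (Eq (Var 0) (Var 1))))) \<in> PA"
| Induction: "arith_fm \<phi> \<Longrightarrow> below_fm (Suc k) \<phi> \<Longrightarrow>
    Alls k (Imp (And (subst_fm 0 Zero \<phi>)
                     (All (Imp \<phi> (subst_fm 0 (Succ (Var 0)) (lift_fm 1 \<phi>)))))
                (All \<phi>)) \<in> PA"


section \<open>Codes\<close>

text \<open>
  This pairing is a bijection onto the positive numbers, it exceeds both of its arguments, and it
  is given by a term of the language of arithmetic.
\<close>

definition pr :: "nat \<Rightarrow> nat \<Rightarrow> nat" where
  "pr a b = 2 ^ a * (2 * b + 1)"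

definition pr_tm :: "tm \<Rightarrow> tm \<Rightarrow> tm" where
  "pr_tm s t = Mul (Expo (num 2) s) (Succ (Mul (num 2) t))"

definition code_list :: "nat list \<Rightarrow> nat" where
  "code_list xs = foldr pr xs 0"

fun code_tm :: "tm \<Rightarrow> nat" where
  "code_tm (Var i) = pr 0 i"
| "code_tm Zero = pr 1 0"
| "code_tm (Succ t) = pr 2 (code_tm t)"
| "code_tm (Add s t) = pr 3 (pr (code_tm s) (code_tm t))"
| "code_tm (Mul s t) = pr 4 (pr (code_tm s) (code_tm t))"
| "code_tm (Expo s t) = pr 5 (pr (code_tm s) (code_tm t))"
| "code_tm (Fn f ts) = pr 6 (pr f (code_list (map code_tm ts)))"

fun code_fm :: "fm \<Rightarrow> nat" where
  "code_fm (Eq s t) = pr 0 (pr (code_tm s) (code_tm t))"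
| "code_fm (Less s t) = pr 1 (pr (code_tm s) (code_tm t))"
| "code_fm (Rl p ts) = pr 2 (pr p (code_list (map code_tm ts)))"
| "code_fm Fls = pr 3 0"
| "code_fm (Neg \<phi>) = pr 4 (code_fm \<phi>)"
| "code_fm (And \<phi> \<psi>) = pr 5 (pr (code_fm \<phi>) (code_fm \<psi>))"
| "code_fm (Or \<phi> \<psi>) = pr 6 (pr (code_fm \<phi>) (code_fm \<psi>))"
| "code_fm (Imp \<phi> \<psi>) = pr 7 (pr (code_fm \<phi>) (code_fm \<psi>))"
| "code_fm (All \<phi>) = pr 8 (code_fm \<phi>)"
| "code_fm (Exi \<phi>) = pr 9 (code_fm \<phi>)"

text \<open>A rational is coded by its numerator and denominator in lowest terms.\<close>

definition code_rat :: "rat \<Rightarrow> nat" where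
  "code_rat q = (case quotient_of q of (a, b) \<Rightarrow> pr (int_encode a) (nat b))"

definition sentence_codes :: "nat list \<Rightarrow> nat list \<Rightarrow> nat set" where
  "sentence_codes fs rs = code_fm ` {\<phi>. sentence fs rs \<phi>}"


lemma pr_inject [simp]: "pr a b = pr c d \<longleftrightarrow> a = c \<and> b = d"
proof
  have *: "a = c \<and> b = d" if "pr a b = pr c d" "a \<le> c" for a b c d
  proof -
    from \<open>a \<le> c\<close> obtain m where m: "c = a + m"
      using le_Suc_ex by blast
    have "2 ^ a * (2 * b + 1) = 2 ^ a * (2 ^ m * (2 * d + 1))"
      using that(1) unfolding pr_def m power_add mult.assoc .
    then have eq: "2 * b + 1 = 2 ^ m * (2 * d + 1)"
      by (metis mult_left_cancel power_eq_0_iff zero_neq_numeral)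
    then have "odd ((2::nat) ^ m * (2 * d + 1))"
      by (metis even_mult_iff even_plus_one_iff even_numeral)
    then have "m = 0"
      by simp
    with eq m show ?thesis
      by simp
  qed
  show "a = c \<and> b = d" if "pr a b = pr c d"
    using *[of a b c d] *[of c d a b] that by (metis nat_le_linear)
qed simp

lemma pr_pos [simp]: "0 < pr a b" "pr a b \<noteq> 0" "0 \<noteq> pr a b"
  by (simp_all add: pr_def)

lemma less_pr: "a < pr a b" "b < pr a b"
proof -
  have "a < 2 ^ a"
    by (rule less_exp)
  also have "2 ^ a * 1 \<le> pr a b"
    unfolding pr_def by (rule mult_le_mono2) simp
  finally show "a < pr a b"
    by simp
  have "b < 1 * (2 * b + 1)"
    by simp
  also have "\<dots> \<le> pr a b"
    unfolding pr_def by (rule mult_le_mono1) simp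
  finally show "b < pr a b" .
qed

lemma code_list_simps [simp]:
  "code_list [] = 0" "code_list (x # xs) = pr x (code_list xs)"
  by (simp_all add: code_list_def)

lemma code_list_inject: "code_list xs = code_list ys \<longleftrightarrow> xs = ys"
proof (induction xs arbitrary: ys)
  case Nil
  show ?case
    by (cases ys) simp_all
next
  case (Cons x xs)
  then show ?case
    by (cases ys) simp_all
qed

lemma code_tm_inject [simp]: "code_tm s = code_tm t \<longleftrightarrow> s = t"
proof (induction s arbitrary: t)
  case (Fn f ts)
  have "map code_tm ts = map code_tm us \<longleftrightarrow> ts = us" for us
  proof
    assume eq: "map code_tm ts = map code_tm us"
    then have "length ts = length us"
      by (metis length_map)
    then show "ts = us"
      using eq Fn by (auto simp: list_eq_iff_nth_eq)
  qed simp
  then show ?case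
    by (cases t) (simp_all add: code_list_inject)
qed (case_tac t; simp)+

lemma map_code_tm_inject [simp]: "map code_tm ts = map code_tm us \<longleftrightarrow> ts = us"
  by (rule inj_map_eq_map) (simp add: inj_def)

lemma code_fm_inject [simp]: "code_fm \<phi> = code_fm \<psi> \<longleftrightarrow> \<phi> = \<psi>"
  by (induction \<phi> arbitrary: \<psi>) (case_tac \<psi>; simp add: code_list_inject)+

lemma inj_code_fm: "inj code_fm"
  by (simp add: inj_def)

lemma code_rat_inject [simp]: "code_rat p = code_rat q \<longleftrightarrow> p = q"
proof
  assume eq: "code_rat p = code_rat q"
  obtain a b c d where qs: "quotient_of p = (a, b)" "quotient_of q = (c, d)"
    by fastforce
  then have "b > 0" "d > 0"
    using quotient_of_denom_pos by blast+
  moreover have "int_encode a = int_encode c" "nat b = nat d"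
    using eq qs by (simp_all add: code_rat_def)
  ultimately have "a = c" "b = d"
    using inj_int_encode[of UNIV] by (simp_all add: inj_eq)
  with qs show "p = q"
    by (simp add: quotient_of_inject)
qed simp


section \<open>An arithmetical formula for sentencehood\<close>

abbreviation lift_tm0 :: "tm \<Rightarrow> tm" ("_\<up>" [1000] 1000) where
  "t\<up> \<equiv> lift_tm 0 t"

text \<open>
  Finite sets of numbers are coded by their binary expansions: \<open>a\<close> is an element of \<open>s\<close> iff
  \<open>s = 2\<^sup>a * (2 * q + 1) + r\<close> for some \<open>q\<close> and some \<open>r < 2\<^sup>a\<close>.
\<close>

definition mem_fm :: "tm \<Rightarrow> tm \<Rightarrow> fm" where
  "mem_fm a s = Exi (Exi (And (Eq (s\<up>\<up>) (Add (pr_tm (a\<up>\<up>) (Var 1)) (Var 0)))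
                             (Less (Var 0) (Expo (num 2) (a\<up>\<up>)))))"

text \<open>
  The formula \<open>sent_fm\<close> says that there is a finite set \<open>s\<close> of entries, each of which is justified
  by other entries of \<open>s\<close> with smaller codes, containing the entry ``\<open>x\<close> is a formula with free
  indices below 0''. The three kinds of entries are ``\<open>c\<close> is a term with indices below \<open>k\<close>'',
  ``\<open>c\<close> is a list of \<open>j\<close> such terms'' and ``\<open>c\<close> is a formula with free indices below \<open>k\<close>''.
\<close>

definition tm_in :: "tm \<Rightarrow> tm \<Rightarrow> tm \<Rightarrow> fm" where
  "tm_in s k c = mem_fm (pr_tm (num 0) (pr_tm k c)) s"

definition tms_in :: "tm \<Rightarrow> tm \<Rightarrow> tm \<Rightarrow> tm \<Rightarrow> fm" where
  "tms_in s k j c = mem_fm (pr_tm (num 1) (pr_tm k (pr_tm j c))) s"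

definition fm_in :: "tm \<Rightarrow> tm \<Rightarrow> tm \<Rightarrow> fm" where
  "fm_in s k c = mem_fm (pr_tm (num 2) (pr_tm k c)) s"

definition tm_step :: "nat list \<Rightarrow> tm \<Rightarrow> tm \<Rightarrow> tm \<Rightarrow> fm" where
  "tm_step fs s k c = Ors (
     [Exi (And (Less (Var 0) (k\<up>)) (Eq (c\<up>) (pr_tm (num 0) (Var 0)))),
      Eq c (pr_tm (num 1) Zero),
      Exi (And (tm_in (s\<up>) (k\<up>) (Var 0)) (Eq (c\<up>) (pr_tm (num 2) (Var 0))))]
     @ map (\<lambda>i. Exi (Exi (And (And (tm_in (s\<up>\<up>) (k\<up>\<up>) (Var 1)) (tm_in (s\<up>\<up>) (k\<up>\<up>) (Var 0)))
                          (Eq (c\<up>\<up>) (pr_tm (num i) (pr_tm (Var 1) (Var 0))))))) [3, 4, 5]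
     @ map (\<lambda>f. Exi (And (tms_in (s\<up>) (k\<up>) (num (fs ! f)) (Var 0))
                          (Eq (c\<up>) (pr_tm (num 6) (pr_tm (num f) (Var 0)))))) [0..<length fs])"

definition tms_step :: "tm \<Rightarrow> tm \<Rightarrow> tm \<Rightarrow> tm \<Rightarrow> fm" where
  "tms_step s k j c = Or (And (Eq j Zero) (Eq c Zero))
     (Exi (Exi (Exi (And
        (And (Eq (j\<up>\<up>\<up>) (Succ (Var 2))) (Eq (c\<up>\<up>\<up>) (pr_tm (Var 1) (Var 0))))
        (And (tm_in (s\<up>\<up>\<up>) (k\<up>\<up>\<up>) (Var 1)) (tms_in (s\<up>\<up>\<up>) (k\<up>\<up>\<up>) (Var 2) (Var 0)))))))"

definition fm_step :: "nat list \<Rightarrow> tm \<Rightarrow> tm \<Rightarrow> tm \<Rightarrow> fm" where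
  "fm_step rs s k c = Ors (
     map (\<lambda>i. Exi (Exi (And (And (tm_in (s\<up>\<up>) (k\<up>\<up>) (Var 1)) (tm_in (s\<up>\<up>) (k\<up>\<up>) (Var 0)))
                        (Eq (c\<up>\<up>) (pr_tm (num i) (pr_tm (Var 1) (Var 0))))))) [0, 1]
     @ map (\<lambda>p. Exi (And (tms_in (s\<up>) (k\<up>) (num (rs ! p)) (Var 0))
                          (Eq (c\<up>) (pr_tm (num 2) (pr_tm (num p) (Var 0)))))) [0..<length rs]
     @ [Eq c (pr_tm (num 3) Zero),
        Exi (And (fm_in (s\<up>) (k\<up>) (Var 0)) (Eq (c\<up>) (pr_tm (num 4) (Var 0))))]
     @ map (\<lambda>i. Exi (Exi (And (And (fm_in (s\<up>\<up>) (k\<up>\<up>) (Var 1)) (fm_in (s\<up>\<up>) (k\<up>\<up>) (Var 0)))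
                          (Eq (c\<up>\<up>) (pr_tm (num i) (pr_tm (Var 1) (Var 0))))))) [5, 6, 7]
     @ map (\<lambda>i. Exi (And (fm_in (s\<up>) (Succ (k\<up>)) (Var 0)) (Eq (c\<up>) (pr_tm (num i) (Var 0))))) [8, 9])"

definition sent_fm :: "nat list \<Rightarrow> nat list \<Rightarrow> fm" where
  "sent_fm fs rs = Exi (And (fm_in (Var 0) Zero (Var 1)) (And
     (All (All (Imp (tm_in (Var 2) (Var 1) (Var 0)) (tm_step fs (Var 2) (Var 1) (Var 0)))))
     (And
     (All (All (All (Imp (tms_in (Var 3) (Var 2) (Var 1) (Var 0))
                         (tms_step (Var 3) (Var 2) (Var 1) (Var 0))))))
     (All (All (Imp (fm_in (Var 2) (Var 1) (Var 0)) (fm_step rs (Var 2) (Var 1) (Var 0))))))))"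

lemma eval_lift [simp]: "eval M (case_nat x e) (t\<up>) = eval M e t"
  by (induction t) (simp_all add: comp_def cong: map_cong)

lemma eval_num [simp]: "eval M e (num n) = n"
  by (induction n) (simp_all add: num_def)

lemma eval_pr [simp]: "eval M e (pr_tm s t) = pr (eval M e s) (eval M e t)"
  by (simp add: pr_tm_def pr_def)

lemma sat_Ors [simp]: "sat M e (Ors \<phi>s) \<longleftrightarrow> (\<exists>\<phi>\<in>set \<phi>s. sat M e \<phi>)"
  by (induction \<phi>s) (simp_all add: Ors_def)

lemma sat_mem_fm [simp]: "sat M e (mem_fm a s) \<longleftrightarrow> eval M e a \<in> set_decode (eval M e s)"
proof -
  have "(\<exists>q r. n = pr k q + r \<and> r < 2 ^ k) \<longleftrightarrow> odd (n div 2 ^ k)" for n k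
  proof
    assume "\<exists>q r. n = pr k q + r \<and> r < 2 ^ k"
    then obtain q r where n: "n = 2 ^ k * (2 * q + 1) + r" "r < 2 ^ k"
      by (auto simp: pr_def)
    then have "n div 2 ^ k = 2 * q + 1"
      by (metis add.right_neutral div_less div_mult_self4 power_eq_0_iff zero_neq_numeral add.commute)
    then show "odd (n div 2 ^ k)"
      by simp
  next
    assume "odd (n div 2 ^ k)"
    then obtain q where "n div 2 ^ k = 2 * q + 1"
      by (rule oddE)
    then have "n = pr k q + n mod 2 ^ k"
      unfolding pr_def by (metis mult_div_mod_eq)
    then show "\<exists>q r. n = pr k q + r \<and> r < 2 ^ k"
      by (metis mod_less_divisor pos2 zero_less_power)
  qed
  then show ?thesis
    by (simp add: mem_fm_def set_decode_def)
qed

lemma sat_steps: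
  "sat M e (tm_in s k c) \<longleftrightarrow> pr 0 (pr (eval M e k) (eval M e c)) \<in> set_decode (eval M e s)"
  "sat M e (tms_in s k j c) \<longleftrightarrow>
     pr 1 (pr (eval M e k) (pr (eval M e j) (eval M e c))) \<in> set_decode (eval M e s)"
  "sat M e (fm_in s k c) \<longleftrightarrow> pr 2 (pr (eval M e k) (eval M e c)) \<in> set_decode (eval M e s)"
  by (simp_all add: tm_in_def tms_in_def fm_in_def)

definition tm_just :: "nat list \<Rightarrow> nat set \<Rightarrow> nat \<Rightarrow> nat \<Rightarrow> bool" where
  "tm_just fs S k c \<longleftrightarrow>
     (\<exists>i<k. c = pr 0 i) \<or> c = pr 1 0 \<or> (\<exists>d. pr 0 (pr k d) \<in> S \<and> c = pr 2 d) \<or>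
     (\<exists>i\<in>{3, 4, 5}. \<exists>a b. pr 0 (pr k a) \<in> S \<and> pr 0 (pr k b) \<in> S \<and> c = pr i (pr a b)) \<or>
     (\<exists>f\<in>{0..<length fs}. \<exists>d. pr 1 (pr k (pr (fs ! f) d)) \<in> S \<and> c = pr 6 (pr f d))"

definition tms_just :: "nat set \<Rightarrow> nat \<Rightarrow> nat \<Rightarrow> nat \<Rightarrow> bool" where
  "tms_just S k j c \<longleftrightarrow> j = 0 \<and> c = 0 \<or>
     (\<exists>j' a b. j = Suc j' \<and> c = pr a b \<and> pr 0 (pr k a) \<in> S \<and> pr 1 (pr k (pr j' b)) \<in> S)"

definition fm_just :: "nat list \<Rightarrow> nat set \<Rightarrow> nat \<Rightarrow> nat \<Rightarrow> bool" where
  "fm_just rs S k c \<longleftrightarrow>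
     (\<exists>i\<in>{0, 1}. \<exists>a b. pr 0 (pr k a) \<in> S \<and> pr 0 (pr k b) \<in> S \<and> c = pr i (pr a b)) \<or>
     c = pr 3 0 \<or> (\<exists>d. pr 2 (pr k d) \<in> S \<and> c = pr 4 d) \<or>
     (\<exists>i\<in>{5, 6, 7}. \<exists>a b. pr 2 (pr k a) \<in> S \<and> pr 2 (pr k b) \<in> S \<and> c = pr i (pr a b)) \<or>
     (\<exists>i\<in>{8, 9}. \<exists>d. pr 2 (pr (Suc k) d) \<in> S \<and> c = pr i d) \<or>
     (\<exists>p\<in>{0..<length rs}. \<exists>d. pr 1 (pr k (pr (rs ! p) d)) \<in> S \<and> c = pr 2 (pr p d))"

definition justified :: "nat list \<Rightarrow> nat list \<Rightarrow> nat set \<Rightarrow> bool" where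
  "justified fs rs S \<longleftrightarrow>
     (\<forall>k c. pr 0 (pr k c) \<in> S \<longrightarrow> tm_just fs S k c) \<and>
     (\<forall>k j c. pr 1 (pr k (pr j c)) \<in> S \<longrightarrow> tms_just S k j c) \<and>
     (\<forall>k c. pr 2 (pr k c) \<in> S \<longrightarrow> fm_just rs S k c)"

lemma sat_tm_step:
  "sat M e (tm_step fs s k c) \<longleftrightarrow> tm_just fs (set_decode (eval M e s)) (eval M e k) (eval M e c)"
  by (simp add: tm_step_def tm_just_def sat_steps bex_Un)

lemma sat_tms_step:
  "sat M e (tms_step s k j c) \<longleftrightarrow>
     tms_just (set_decode (eval M e s)) (eval M e k) (eval M e j) (eval M e c)"
  by (simp add: tms_step_def tms_just_def sat_steps numeral_eq_Suc)

lemma sat_fm_step: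
  "sat M e (fm_step rs s k c) \<longleftrightarrow> fm_just rs (set_decode (eval M e s)) (eval M e k) (eval M e c)"
  by (simp add: fm_step_def fm_just_def sat_steps bex_Un)

lemma sat_sent_fm:
  "sat M e (sent_fm fs rs) \<longleftrightarrow> (\<exists>S. finite S \<and> pr 2 (pr 0 (e 0)) \<in> S \<and> justified fs rs S)"
proof -
  have "sat M e (sent_fm fs rs) \<longleftrightarrow>
    (\<exists>s. pr 2 (pr 0 (e 0)) \<in> set_decode s \<and> justified fs rs (set_decode s))"
    by (simp add: sent_fm_def justified_def sat_steps sat_tm_step sat_tms_step sat_fm_step
        numeral_eq_Suc)
  also have "\<dots> \<longleftrightarrow> (\<exists>S. finite S \<and> pr 2 (pr 0 (e 0)) \<in> S \<and> justified fs rs S)"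
    by (metis finite_set_decode set_encode_inverse)
  finally show ?thesis .
qed

lemma just_mono:
  assumes "S \<subseteq> T"
  shows "tm_just fs S k c \<longrightarrow> tm_just fs T k c"
    and "tms_just S k j c \<longrightarrow> tms_just T k j c"
    and "fm_just rs S k c \<longrightarrow> fm_just rs T k c"
  unfolding tm_just_def tms_just_def fm_just_def Bex_def
  by (intro disj_mono ex_mono conj_mono imp_refl in_mono[OF assms])+

lemma justified_Un:
  assumes "justified fs rs S" "justified fs rs T"
  shows "justified fs rs (S \<union> T)"
  using assms just_mono[of S "S \<union> T"] just_mono[of T "S \<union> T"]
  unfolding justified_def Un_iff by simp

lemma justified_insert:
  assumes "justified fs rs S"
  shows "tm_just fs S k c \<Longrightarrow> justified fs rs (insert (pr 0 (pr k c)) S)"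
    and "tms_just S k j c \<Longrightarrow> justified fs rs (insert (pr 1 (pr k (pr j c))) S)"
    and "fm_just rs S k c \<Longrightarrow> justified fs rs (insert (pr 2 (pr k c)) S)"
  using assms just_mono[OF subset_insertI[of S]] unfolding justified_def by simp_all

definition derivable :: "nat list \<Rightarrow> nat list \<Rightarrow> nat \<Rightarrow> bool" where
  "derivable fs rs x \<longleftrightarrow> (\<exists>S. finite S \<and> x \<in> S \<and> justified fs rs S)"

lemma derivable_pair:
  assumes "derivable fs rs x" "derivable fs rs y"
  obtains S where "finite S" "x \<in> S" "y \<in> S" "justified fs rs S"
  using assms unfolding derivable_def by (meson UnCI finite_UnI justified_Un)

lemma derivable_intros:
  "finite S \<Longrightarrow> justified fs rs S \<Longrightarrow> tm_just fs S k c \<Longrightarrow> derivable fs rs (pr 0 (pr k c))"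
  "finite S \<Longrightarrow> justified fs rs S \<Longrightarrow> tms_just S k j c \<Longrightarrow> derivable fs rs (pr 1 (pr k (pr j c)))"
  "finite S \<Longrightarrow> justified fs rs S \<Longrightarrow> fm_just rs S k c \<Longrightarrow> derivable fs rs (pr 2 (pr k c))"
  unfolding derivable_def by (meson finite_insert insertI1 justified_insert)+

lemma justified_empty: "justified fs rs {}"
  by (simp add: justified_def)

lemma derivable_tms:
  assumes "\<And>t. t \<in> set ts \<Longrightarrow> derivable fs rs (pr 0 (pr k (code_tm t)))"
  shows "derivable fs rs (pr 1 (pr k (pr (length ts) (code_list (map code_tm ts)))))"
  using assms
proof (induction ts)
  case Nil
  show ?case
    by (rule derivable_intros(2)[OF finite.emptyI justified_empty]) (simp add: tms_just_def)
next
  case (Cons t ts)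
  have "derivable fs rs (pr 0 (pr k (code_tm t)))"
    "derivable fs rs (pr 1 (pr k (pr (length ts) (code_list (map code_tm ts)))))"
    using Cons by simp_all
  then show ?case
    by (rule derivable_pair) (rule derivable_intros(2), auto simp: tms_just_def)
qed

lemma derivable_tm:
  "lang_tm fs t \<Longrightarrow> below_tm k t \<Longrightarrow> derivable fs rs (pr 0 (pr k (code_tm t)))"
proof (induction t)
  case (Fn f ts)
  then have "derivable fs rs (pr 1 (pr k (pr (length ts) (code_list (map code_tm ts)))))"
    by (intro derivable_tms) auto
  then obtain S where "finite S" "justified fs rs S"
    "pr 1 (pr k (pr (length ts) (code_list (map code_tm ts)))) \<in> S"
    by (auto simp: derivable_def)
  with Fn.prems show ?case
    by (intro derivable_intros(1)[of S]) (auto simp: tm_just_def)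
next
  case (Var i)
  then show ?case
    by (intro derivable_intros(1)[OF finite.emptyI justified_empty]) (simp add: tm_just_def)
next
  case Zero
  show ?case
    by (intro derivable_intros(1)[OF finite.emptyI justified_empty]) (simp add: tm_just_def)
next
  case (Succ t)
  then obtain S where "finite S" "justified fs rs S" "pr 0 (pr k (code_tm t)) \<in> S"
    by (auto simp: derivable_def)
  then show ?case
    by (intro derivable_intros(1)[of S]) (auto simp: tm_just_def)
next
  case (Add s t)
  then have "derivable fs rs (pr 0 (pr k (code_tm s)))" "derivable fs rs (pr 0 (pr k (code_tm t)))"
    by simp_all
  then show ?case
    by (rule derivable_pair) (rule derivable_intros(1), auto simp: tm_just_def)
next
  case (Mul s t)
  then have "derivable fs rs (pr 0 (pr k (code_tm s)))" "derivable fs rs (pr 0 (pr k (code_tm t)))"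
    by simp_all
  then show ?case
    by (rule derivable_pair) (rule derivable_intros(1), auto simp: tm_just_def)
next
  case (Expo s t)
  then have "derivable fs rs (pr 0 (pr k (code_tm s)))" "derivable fs rs (pr 0 (pr k (code_tm t)))"
    by simp_all
  then show ?case
    by (rule derivable_pair) (rule derivable_intros(1), auto simp: tm_just_def)
qed

lemma derivable_fm:
  "lang_fm fs rs \<phi> \<Longrightarrow> below_fm k \<phi> \<Longrightarrow> derivable fs rs (pr 2 (pr k (code_fm \<phi>)))"
proof (induction \<phi> arbitrary: k)
  case (Eq s t)
  then have "derivable fs rs (pr 0 (pr k (code_tm s)))" "derivable fs rs (pr 0 (pr k (code_tm t)))"
    by (simp_all add: derivable_tm)
  then show ?case
    by (rule derivable_pair) (rule derivable_intros(3), auto simp: fm_just_def)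
next
  case (Less s t)
  then have "derivable fs rs (pr 0 (pr k (code_tm s)))" "derivable fs rs (pr 0 (pr k (code_tm t)))"
    by (simp_all add: derivable_tm)
  then show ?case
    by (rule derivable_pair) (rule derivable_intros(3), auto simp: fm_just_def)
next
  case (Rl p ts)
  then have "derivable fs rs (pr 1 (pr k (pr (length ts) (code_list (map code_tm ts)))))"
    by (intro derivable_tms derivable_tm) auto
  then obtain S where "finite S" "justified fs rs S"
    "pr 1 (pr k (pr (length ts) (code_list (map code_tm ts)))) \<in> S"
    by (auto simp: derivable_def)
  with Rl.prems show ?case
    by (intro derivable_intros(3)[of S]) (auto simp: fm_just_def)
next
  case Fls
  show ?case
    by (intro derivable_intros(3)[OF finite.emptyI justified_empty]) (simp add: fm_just_def)
next
  case (Neg \<phi>)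
  then have "derivable fs rs (pr 2 (pr k (code_fm \<phi>)))"
    by simp
  then obtain S where "finite S" "justified fs rs S" "pr 2 (pr k (code_fm \<phi>)) \<in> S"
    by (auto simp: derivable_def)
  then show ?case
    by (intro derivable_intros(3)[of S]) (auto simp: fm_just_def)
next
  case (And \<phi> \<psi>)
  then have "derivable fs rs (pr 2 (pr k (code_fm \<phi>)))" "derivable fs rs (pr 2 (pr k (code_fm \<psi>)))"
    by simp_all
  then show ?case
    by (rule derivable_pair) (rule derivable_intros(3), auto simp: fm_just_def)
next
  case (Or \<phi> \<psi>)
  then have "derivable fs rs (pr 2 (pr k (code_fm \<phi>)))" "derivable fs rs (pr 2 (pr k (code_fm \<psi>)))"
    by simp_all
  then show ?case
    by (rule derivable_pair) (rule derivable_intros(3), auto simp: fm_just_def)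
next
  case (Imp \<phi> \<psi>)
  then have "derivable fs rs (pr 2 (pr k (code_fm \<phi>)))" "derivable fs rs (pr 2 (pr k (code_fm \<psi>)))"
    by simp_all
  then show ?case
    by (rule derivable_pair) (rule derivable_intros(3), auto simp: fm_just_def)
next
  case (All \<phi>)
  then have "derivable fs rs (pr 2 (pr (Suc k) (code_fm \<phi>)))"
    by simp
  then obtain S where "finite S" "justified fs rs S" "pr 2 (pr (Suc k) (code_fm \<phi>)) \<in> S"
    by (auto simp: derivable_def)
  then show ?case
    by (intro derivable_intros(3)[of S]) (auto simp: fm_just_def)
next
  case (Exi \<phi>)
  then have "derivable fs rs (pr 2 (pr (Suc k) (code_fm \<phi>)))"
    by simp
  then obtain S where "finite S" "justified fs rs S" "pr 2 (pr (Suc k) (code_fm \<phi>)) \<in> S"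
    by (auto simp: derivable_def)
  then show ?case
    by (intro derivable_intros(3)[of S]) (auto simp: fm_just_def)
qed

lemma justified_tm:
  assumes S: "justified fs rs S"
  shows "(pr 0 (pr k c) \<in> S \<longrightarrow> (\<exists>t. code_tm t = c \<and> lang_tm fs t \<and> below_tm k t)) \<and>
    (pr 1 (pr k (pr j c)) \<in> S \<longrightarrow> (\<exists>ts. code_list (map code_tm ts) = c \<and> length ts = j \<and>
       (\<forall>t\<in>set ts. lang_tm fs t \<and> below_tm k t)))"
proof (induction c arbitrary: j rule: less_induct)
  case (less c)
  have IH1: "\<exists>t. code_tm t = d \<and> lang_tm fs t \<and> below_tm k t" if "pr 0 (pr k d) \<in> S" "d < c" for d
    using less that by blast
  have IH2: "\<exists>ts. code_list (map code_tm ts) = d \<and> length ts = j \<and>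
       (\<forall>t\<in>set ts. lang_tm fs t \<and> below_tm k t)" if "pr 1 (pr k (pr j d)) \<in> S" "d < c" for d j
    using less that by blast
  have "\<exists>t. code_tm t = c \<and> lang_tm fs t \<and> below_tm k t" if "pr 0 (pr k c) \<in> S"
  proof -
    have "tm_just fs S k c"
      using S that by (simp add: justified_def)
    then consider i where "i < k" "c = pr 0 i" | "c = pr 1 0"
      | d where "pr 0 (pr k d) \<in> S" "c = pr 2 d"
      | i a b where "i \<in> {3, 4, 5}" "pr 0 (pr k a) \<in> S" "pr 0 (pr k b) \<in> S" "c = pr i (pr a b)"
      | f d where "f < length fs" "pr 1 (pr k (pr (fs ! f) d)) \<in> S" "c = pr 6 (pr f d)"
      unfolding tm_just_def by fastforce
    then show ?thesis
    proof cases
      case 1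
      then show ?thesis
        by (intro exI[of _ "Var i"]) simp
    next
      case 2
      then show ?thesis
        by (intro exI[of _ Zero]) simp
    next
      case 3
      then obtain t where "code_tm t = d" "lang_tm fs t" "below_tm k t"
        using IH1 less_pr by blast
      with 3 show ?thesis
        by (intro exI[of _ "Succ t"]) simp
    next
      case 4
      then have "a < c" "b < c"
        by (meson less_pr less_trans)+
      with 4 obtain t u where "code_tm t = a" "lang_tm fs t" "below_tm k t"
        "code_tm u = b" "lang_tm fs u" "below_tm k u"
        using IH1 by metis
      moreover from this 4 have "c = code_tm (Add t u) \<or> c = code_tm (Mul t u) \<or> c = code_tm (Expo t u)"
        by auto
      ultimately show ?thesis
        by (metis lang_tm.simps(4,5,6) below_tm.simps(4,5,6))
    next
      case 5
      then have "d < c"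
        by (meson less_pr less_trans)
      with 5 obtain ts where "code_list (map code_tm ts) = d" "length ts = fs ! f"
        "\<forall>t\<in>set ts. lang_tm fs t \<and> below_tm k t"
        using IH2 by blast
      with 5 show ?thesis
        by (intro exI[of _ "Fn f ts"]) simp
    qed
  qed
  moreover have "\<exists>ts. code_list (map code_tm ts) = c \<and> length ts = j \<and>
       (\<forall>t\<in>set ts. lang_tm fs t \<and> below_tm k t)" if "pr 1 (pr k (pr j c)) \<in> S"
  proof -
    have "tms_just S k j c"
      using S that by (simp add: justified_def)
    then consider "j = 0" "c = 0"
      | j' a b where "j = Suc j'" "c = pr a b" "pr 0 (pr k a) \<in> S" "pr 1 (pr k (pr j' b)) \<in> S"
      unfolding tms_just_def by blast
    then show ?thesis
    proof cases
      case 1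
      then show ?thesis
        by simp
    next
      case 2
      then have "a < c" "b < c"
        by (simp_all add: less_pr)
      with 2 obtain t where "code_tm t = a" "lang_tm fs t" "below_tm k t"
        using IH1 by blast
      moreover obtain ts where "code_list (map code_tm ts) = b" "length ts = j'"
        "\<forall>t\<in>set ts. lang_tm fs t \<and> below_tm k t"
        using IH2 2 \<open>b < c\<close> by blast
      ultimately show ?thesis
        using 2 by (intro exI[of _ "t # ts"]) simp
    qed
  qed
  ultimately show ?case
    by blast
qed

lemma justified_fm:
  assumes S: "justified fs rs S"
  shows "pr 2 (pr k c) \<in> S \<Longrightarrow> \<exists>\<phi>. code_fm \<phi> = c \<and> lang_fm fs rs \<phi> \<and> below_fm k \<phi>"
proof (induction c arbitrary: k rule: less_induct)
  case (less c)
  have tm: "\<exists>t. code_tm t = d \<and> lang_tm fs t \<and> below_tm k t" if "pr 0 (pr k d) \<in> S" for d k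
    using justified_tm[OF S] that by blast
  have tms: "\<exists>ts. code_list (map code_tm ts) = d \<and> length ts = j \<and>
       (\<forall>t\<in>set ts. lang_tm fs t \<and> below_tm k t)" if "pr 1 (pr k (pr j d)) \<in> S" for d j k
    using justified_tm[OF S] that by blast
  have "fm_just rs S k c"
    using S less.prems by (simp add: justified_def)
  then show ?case
    unfolding fm_just_def
  proof (elim disjE bexE exE conjE)
    fix i a b
    assume *: "i \<in> {0, 1}" "pr 0 (pr k a) \<in> S" "pr 0 (pr k b) \<in> S" "c = pr i (pr a b)"
    from * obtain t u where "code_tm t = a" "lang_tm fs t" "below_tm k t"
      "code_tm u = b" "lang_tm fs u" "below_tm k u"
      using tm by metis
    moreover from this * have "c = code_fm (Eq t u) \<or> c = code_fm (Less t u)"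
      by auto
    ultimately show ?case
      by (metis lang_fm.simps(1,2) below_fm.simps(1,2))
  next
    assume "c = pr 3 0"
    then show ?case
      by (intro exI[of _ Fls]) simp
  next
    fix d
    assume *: "pr 2 (pr k d) \<in> S" "c = pr 4 d"
    from * obtain \<phi> where "code_fm \<phi> = d" "lang_fm fs rs \<phi>" "below_fm k \<phi>"
      using less.IH less_pr by blast
    with * show ?case
      by (intro exI[of _ "Neg \<phi>"]) simp
  next
    fix i a b
    assume *: "i \<in> {5, 6, 7}" "pr 2 (pr k a) \<in> S" "pr 2 (pr k b) \<in> S" "c = pr i (pr a b)"
    from * have "a < c" "b < c"
      by (meson less_pr less_trans)+
    with * obtain \<phi> \<psi> where "code_fm \<phi> = a" "lang_fm fs rs \<phi>" "below_fm k \<phi>"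
      "code_fm \<psi> = b" "lang_fm fs rs \<psi>" "below_fm k \<psi>"
      using less.IH by metis
    moreover from this *
    have "c = code_fm (And \<phi> \<psi>) \<or> c = code_fm (Or \<phi> \<psi>) \<or> c = code_fm (Imp \<phi> \<psi>)"
      by auto
    ultimately show ?case
      by (metis lang_fm.simps(6,7,8) below_fm.simps(6,7,8))
  next
    fix i d
    assume *: "i \<in> {8, 9}" "pr 2 (pr (Suc k) d) \<in> S" "c = pr i d"
    from * obtain \<phi> where "code_fm \<phi> = d" "lang_fm fs rs \<phi>" "below_fm (Suc k) \<phi>"
      using less.IH less_pr by blast
    moreover from this * have "c = code_fm (All \<phi>) \<or> c = code_fm (Exi \<phi>)"
      by auto
    ultimately show ?case
      by (metis lang_fm.simps(9,10) below_fm.simps(9,10))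
  next
    fix p d
    assume *: "p \<in> {0..<length rs}" "pr 1 (pr k (pr (rs ! p) d)) \<in> S" "c = pr 2 (pr p d)"
    from * obtain ts where "code_list (map code_tm ts) = d" "length ts = rs ! p"
      "\<forall>t\<in>set ts. lang_tm fs t \<and> below_tm k t"
      using tms by blast
    with * show ?case
      by (intro exI[of _ "Rl p ts"]) simp
  qed
qed

theorem sat_N_sent_fm: "sat_N [x] (sent_fm fs rs) \<longleftrightarrow> x \<in> sentence_codes fs rs"
proof
  assume "sat_N [x] (sent_fm fs rs)"
  then obtain S where "pr 2 (pr 0 x) \<in> S" "justified fs rs S"
    by (auto simp: sat_N_def sat_sent_fm env_def)
  then show "x \<in> sentence_codes fs rs"
    using justified_fm by (fastforce simp: sentence_codes_def sentence_def)
next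
  assume "x \<in> sentence_codes fs rs"
  then have "derivable fs rs (pr 2 (pr 0 x))"
    by (auto simp: sentence_codes_def sentence_def derivable_fm)
  then show "sat_N [x] (sent_fm fs rs)"
    by (simp add: sat_N_def sat_sent_fm env_def derivable_def)
qed

lemma lang_num [simp]: "lang_tm fs (num n)" and below_num [simp]: "below_tm k (num n)"
  by (induction n) (simp_all add: num_def)

lemma lang_lift [simp]: "lang_tm fs (t\<up>) = lang_tm fs t"
  by (induction t) simp_all

lemma below_lift [simp]: "below_tm (Suc k) (t\<up>) = below_tm k t"
  by (induction t) simp_all

lemma Ors_syntax [simp]:
  "lang_fm fs rs (Ors \<phi>s) \<longleftrightarrow> (\<forall>\<phi>\<in>set \<phi>s. lang_fm fs rs \<phi>)"
  "below_fm k (Ors \<phi>s) \<longleftrightarrow> (\<forall>\<phi>\<in>set \<phi>s. below_fm k \<phi>)"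
  by (induction \<phi>s) (simp_all add: Ors_def)

lemma sent_fm_syntax: "arith_fm (sent_fm fs rs)" "below_fm 1 (sent_fm fs rs)"
  by (auto simp: sent_fm_def tm_step_def tms_step_def fm_step_def tm_in_def tms_in_def fm_in_def
      mem_fm_def pr_tm_def)

section \<open>Arithmetical definability\<close>

text \<open>
  Functions of \<open>k\<close> arguments are functions on lists of length \<open>k\<close>. The domain is a set \<open>D\<close> of such
  lists, together with a formula \<open>\<delta>\<close>, with free indices below \<open>k\<close>, expressing membership in \<open>D\<close>
  inside PA; for sentence codes this is \<open>sent_fm\<close>, by \<open>sent_fm_syntax\<close> and \<open>sat_N_sent_fm\<close>. In the
  defining formula the value is index 0 and the arguments are the indices \<open>1..k\<close>.
\<close>

definition defined_by :: "nat \<Rightarrow> nat list set \<Rightarrow> fm \<Rightarrow> (nat list \<Rightarrow> rat) \<Rightarrow> fm \<Rightarrow> bool" where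
  "defined_by k D \<delta> g \<phi> \<longleftrightarrow> arith_fm \<phi> \<and> below_fm (Suc k) \<phi> \<and>
     (\<forall>xs\<in>D. \<forall>q. g xs = q \<longleftrightarrow> sat_N (code_rat q # xs) \<phi>) \<and>
     PA \<turnstile> Alls k (Imp \<delta> (Ex1 \<phi>))"

definition approximates :: "nat list set \<Rightarrow> (nat list \<Rightarrow> rat) \<Rightarrow> (nat list \<Rightarrow> real) \<Rightarrow> bool" where
  "approximates D g f \<longleftrightarrow> (\<forall>xs\<in>D. \<forall>n. \<bar>f xs - of_rat (g (xs @ [n]))\<bar> \<le> 1 / 2 ^ n)"

text \<open>
  The domain of an approximation has the additional last argument \<open>n\<close>, which ranges over all
  numbers; so \<open>\<delta>\<close> still expresses membership in it.
\<close>

definition arith_definable :: "nat \<Rightarrow> nat list set \<Rightarrow> fm \<Rightarrow> (nat list \<Rightarrow> real) \<Rightarrow> bool" where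
  "arith_definable k D \<delta> f \<longleftrightarrow>
     (\<exists>g \<phi>. approximates D g f \<and> defined_by (Suc k) {xs @ [n] |xs n. xs \<in> D} \<delta> g \<phi>)"

definition on_codes :: "(fm \<Rightarrow> real) \<Rightarrow> nat list \<Rightarrow> real" where
  "on_codes P xs = P (inv code_fm (hd xs))"

definition arith_definable_prob :: "nat list \<Rightarrow> nat list \<Rightarrow> (fm \<Rightarrow> real) \<Rightarrow> bool" where
  "arith_definable_prob fs rs P \<longleftrightarrow>
     arith_definable 1 {[x] |x. x \<in> sentence_codes fs rs} (sent_fm fs rs) (on_codes P)"

end

theory Submission
  imports Defs
begin

text \<open>
  A sentence of pure arithmetic has the same truth value in every expansion of the standard model.
  Hence it or its negation is valid, and the first two Gaifman-Snir axioms force its probability to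
  be 1 if it is true and 0 if it is false (\<open>gaifman_snir_arith_sentence\<close>). On arithmetical sentences
  \<open>P\<close> is therefore the characteristic function of arithmetical truth, whatever the extra symbols are.

  Given an arithmetically definable approximation \<open>g\<close> of \<open>P\<close>, an arithmetical sentence with code
  \<open>x\<close> is true iff \<open>g(x, 2) > 1/2\<close>, because \<open>g(x, 2)\<close> is within \<open>1/4\<close> of 0 or 1. This inequality is
  an arithmetical formula in \<open>x\<close> (\<open>threshold_fm\<close>), that is, a truth definition for arithmetic, which
  contradicts Tarski's theorem (\<open>Tarski_undefinability\<close>).

  Tarski's theorem is proved by the usual diagonal argument, with the self-substitution
  \<open>\<exists>y. y = \<guillemotleft>numeral of x\<guillemotright> \<and> \<theta>(y)\<close>: its code depends on \<open>x\<close> and the code of \<open>\<theta>\<close> only through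
  pairing and the code of the numeral of \<open>x\<close>, and the latter has a closed form with an exponential
  (\<open>code_tm_num\<close>). So the diagonal function is arithmetical without any coding of sequences.
\<close>

section \<open>Arithmetical sentences in expansions of the standard model\<close>

lemma eval_arith_cong:
  assumes "arith_tm t" "below_tm k t" "\<And>i. i < k \<Longrightarrow> e i = e' i"
  shows "eval M e t = eval M' e' t"
  using assms by (induction t) auto

lemma sat_arith_cong:
  assumes "arith_fm \<phi>" "below_fm k \<phi>" "\<And>i. i < k \<Longrightarrow> e i = e' i"
  shows "sat M e \<phi> \<longleftrightarrow> sat M' e' \<phi>"
  using assms
proof (induction \<phi> arbitrary: k e e')
  case (Eq s t)
  then show ?case
    using eval_arith_cong[of s k e e' M M'] eval_arith_cong[of t k e e' M M'] by simp
next
  case (Less s t)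
  then show ?case
    using eval_arith_cong[of s k e e' M M'] eval_arith_cong[of t k e e' M M'] by simp
next
  case (And \<phi> \<psi>)
  show ?case
    using And.IH(1)[of k e e'] And.IH(2)[of k e e'] And.prems by simp
next
  case (Or \<phi> \<psi>)
  show ?case
    using Or.IH(1)[of k e e'] Or.IH(2)[of k e e'] Or.prems by simp
next
  case (Imp \<phi> \<psi>)
  show ?case
    using Imp.IH(1)[of k e e'] Imp.IH(2)[of k e e'] Imp.prems by simp
next
  case (Neg \<phi>)
  show ?case
    using Neg.IH[of k e e'] Neg.prems by simp
next
  case (All \<phi>)
  have "sat M (case_nat x e) \<phi> \<longleftrightarrow> sat M' (case_nat x e') \<phi>" for x
    using All.prems by (intro All.IH[of "Suc k"]) (auto split: nat.split)
  then show ?case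
    by simp
next
  case (Exi \<phi>)
  have "sat M (case_nat x e) \<phi> \<longleftrightarrow> sat M' (case_nat x e') \<phi>" for x
    using Exi.prems by (intro Exi.IH[of "Suc k"]) (auto split: nat.split)
  then show ?case
    by simp
qed simp_all

lemma sat_arith_sentence:
  assumes "sentence [] [] \<phi>"
  shows "sat M e \<phi> \<longleftrightarrow> sat_N [] \<phi>"
  unfolding sat_N_def using assms by (intro sat_arith_cong[of \<phi> 0]) (simp_all add: sentence_def)

lemma below_tm_mono: "below_tm k t \<Longrightarrow> k \<le> l \<Longrightarrow> below_tm l t"
  by (induction t) auto

lemma below_fm_mono: "below_fm k \<phi> \<Longrightarrow> k \<le> l \<Longrightarrow> below_fm l \<phi>"
  by (induction \<phi> arbitrary: k l) (auto intro: below_tm_mono)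

lemma arith_tm_lang: "arith_tm t \<Longrightarrow> lang_tm fs t"
  by (induction t) auto

lemma arith_fm_lang: "arith_fm \<phi> \<Longrightarrow> lang_fm fs rs \<phi>"
  by (induction \<phi>) (auto intro: arith_tm_lang)

lemma arith_sentence_lang: "sentence [] [] \<phi> \<Longrightarrow> sentence fs rs \<phi>"
  by (simp add: sentence_def arith_fm_lang)

text \<open>
  The value 0 for a false sentence comes from additivity: its negation already has probability 1,
  and so does the disjunction of the two.
\<close>

lemma gaifman_snir_arith_sentence:
  assumes P: "gaifman_snir fs rs P" and \<phi>: "sentence [] [] \<phi>"
  shows "P \<phi> = (if sat_N [] \<phi> then 1 else 0)"
proof -
  have one: "P \<psi> = 1" if "sentence fs rs \<psi>" "valid \<psi>" for \<psi>
    using P that by (auto simp: gaifman_snir_def)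
  have s: "sentence fs rs \<phi>" "sentence fs rs (Neg \<phi>)" "sentence fs rs (Or \<phi> (Neg \<phi>))"
    using arith_sentence_lang[OF \<phi>, of fs rs] by (simp_all add: sentence_def)
  show ?thesis
  proof (cases "sat_N [] \<phi>")
    case True
    then have "valid \<phi>"
      by (simp add: valid_def models_def sat_arith_sentence[OF \<phi>])
    with s True show ?thesis
      by (simp add: one)
  next
    case False
    then have "valid (Neg \<phi>)"
      by (simp add: valid_def models_def sat_arith_sentence[OF \<phi>])
    moreover have "valid (Neg (And \<phi> (Neg \<phi>)))" "valid (Or \<phi> (Neg \<phi>))"
      by (simp_all add: valid_def models_def)
    moreover from this have "P (Or \<phi> (Neg \<phi>)) = P \<phi> + P (Neg \<phi>)"
      using P s unfolding gaifman_snir_def by blast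
    ultimately show ?thesis
      using s False one by simp
  qed
qed

section \<open>Undefinability of arithmetical truth\<close>

text \<open>
  The code \<open>c\<^sub>n\<close> of the numeral of \<open>n\<close> satisfies \<open>c\<^sub>0 = 2\<close> and \<open>c\<^sub>n\<^sub>+\<^sub>1 = 8 * c\<^sub>n + 4\<close>; the fixed point
  \<open>-4/7\<close> of the recursion suggests the normalisation \<open>7 * c\<^sub>n + 4\<close>, which is multiplied by 8 in each
  step.
\<close>

lemma code_tm_num: "7 * code_tm (num n) + 4 = 18 * 8 ^ n"
proof (induction n)
  case 0
  show ?case
    by (simp add: num_def pr_def)
next
  case (Suc n)
  have "code_tm (num (Suc n)) = 8 * code_tm (num n) + 4"
    by (simp add: num_def pr_def)
  with Suc show ?case
    by simp
qed

lemma code_tm_num_iff: "7 * c + 4 = 18 * 8 ^ n \<longleftrightarrow> c = code_tm (num n)"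
  using code_tm_num[of n] by auto

text \<open>
  Equivalent to \<open>subst_fm 0 (num n) \<theta>\<close>, but \<open>\<theta>\<close> itself is a subformula, so that the code is obtained
  from the codes of \<open>\<theta>\<close> and of the numeral by pairing alone; \<open>diag_tm\<close> is the corresponding term.
\<close>

definition inst_fm :: "fm \<Rightarrow> nat \<Rightarrow> fm" where
  "inst_fm \<theta> n = Exi (And (Eq (Var 0) (num n)) \<theta>)"

definition diag_tm :: "tm \<Rightarrow> tm \<Rightarrow> tm" where
  "diag_tm c x = pr_tm (num 9) (pr_tm (num 5)
     (pr_tm (pr_tm (num 0) (pr_tm (pr_tm (num 0) (num 0)) c)) x))"

lemma eval_diag_tm:
  "eval M e c = code_tm (num n) \<Longrightarrow> eval M e x = code_fm \<theta> \<Longrightarrow>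
     eval M e (diag_tm c x) = code_fm (inst_fm \<theta> n)"
  by (simp add: diag_tm_def inst_fm_def)

text \<open>
  If \<open>\<tau>\<close> defines truth, this formula says of \<open>x\<close> that the formula with code \<open>x\<close>, applied to \<open>x\<close>,
  is not true. Its bound variables are the code \<open>c\<close> of the numeral of \<open>x\<close>, then the code handed
  over to \<open>\<tau>\<close>.
\<close>

definition liar_fm :: "fm \<Rightarrow> fm" where
  "liar_fm \<tau> = Neg (Exi (And
     (Eq (Add (Mul (num 7) (Var 0)) (num 4)) (Mul (num 18) (Expo (num 8) (Var 1))))
     (Exi (And (Eq (Var 0) (diag_tm (Var 1) (Var 2))) \<tau>))))"

lemma sat_liar_fm:
  "sat M (case_nat (code_fm \<theta>) e) (liar_fm \<tau>) \<longleftrightarrow>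
    \<not> sat M (case_nat (code_fm (inst_fm \<theta> (code_fm \<theta>)))
        (case_nat (code_tm (num (code_fm \<theta>))) (case_nat (code_fm \<theta>) e))) \<tau>"
  by (simp add: liar_fm_def code_tm_num_iff eval_diag_tm[where \<theta> = \<theta> and n = "code_fm \<theta>"]
      numeral_2_eq_2)

theorem Tarski_undefinability:
  assumes \<tau>: "arith_fm \<tau>" "below_fm 1 \<tau>"
    and truth: "\<And>\<phi>. sentence [] [] \<phi> \<Longrightarrow> sat_N [code_fm \<phi>] \<tau> \<longleftrightarrow> sat_N [] \<phi>"
  shows False
proof -
  define \<theta> where "\<theta> = liar_fm \<tau>"
  define G where "G = inst_fm \<theta> (code_fm \<theta>)"
  have G: "sentence [] [] G"
    using \<tau>(1) below_fm_mono[OF \<tau>(2)]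
    by (simp add: G_def \<theta>_def sentence_def inst_fm_def liar_fm_def diag_tm_def pr_tm_def)
  have "sat_N [] G \<longleftrightarrow> sat (\<lambda>f as. 0, \<lambda>p as. False) (case_nat (code_fm \<theta>) (env [])) (liar_fm \<tau>)"
    unfolding sat_N_def by (simp add: G_def inst_fm_def flip: \<theta>_def)
  also have "\<dots> \<longleftrightarrow> \<not> sat_N [code_fm G] \<tau>"
    unfolding sat_N_def sat_liar_fm G_def[symmetric]
    by (subst sat_arith_cong[OF \<tau>]) (simp_all add: env_def)
  finally show False
    using truth[OF G] by blast
qed

section \<open>A truth definition from an approximation\<close>

text \<open>
  A nonnegative integer \<open>a\<close> is encoded as \<open>2 * a\<close> and a negative one as an odd number, so the value
  with code \<open>pr (2 * a) b\<close> is \<open>a / b\<close>, which exceeds \<open>1/2\<close> iff \<open>b < 2 * a\<close>. Positivity of \<open>b\<close> and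
  coprimality exclude numbers that code no rational: a formula defining \<open>g\<close> is compared with \<open>g\<close>
  only at codes of rationals. Coprimality is spelled out in the form in which a formula expresses it.
\<close>

definition half_exceeding_code :: "nat \<Rightarrow> bool" where
  "half_exceeding_code y \<longleftrightarrow> (\<exists>a b. y = pr (2 * a) b \<and> 0 < b \<and> b < 2 * a \<and>
     (\<forall>u v w. a = u * v \<and> b = u * w \<longrightarrow> u = 1))"

lemma coprime_nat_iff_factors: "coprime (a :: nat) b \<longleftrightarrow> (\<forall>u v w. a = u * v \<and> b = u * w \<longrightarrow> u = 1)"
  unfolding coprime_def dvd_def by (metis nat_dvd_1_iff_1 dvd_def)

lemma half_exceeding_code_iff: "half_exceeding_code y \<longleftrightarrow> (\<exists>q > 1 / 2. y = code_rat q)"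
proof
  assume "half_exceeding_code y"
  then obtain a b where y: "y = pr (2 * a) b" and b: "0 < b" "b < 2 * a" and "coprime a b"
    by (auto simp: half_exceeding_code_def coprime_nat_iff_factors)
  define q where "q = Fract (int a) (int b)"
  have "quotient_of q = (int a, int b)"
    using b \<open>coprime a b\<close> by (simp add: q_def quotient_of_Fract normalize_def)
  then have "y = code_rat q"
    by (simp add: code_rat_def y int_encode_def sum_encode_def)
  moreover have "1 / 2 < q"
  proof -
    have "(of_nat b :: rat) < of_nat (2 * a)"
      using b by (simp only: of_nat_less_iff)
    then show ?thesis
      using b by (simp add: q_def Fract_of_int_quotient field_simps)
  qed
  ultimately show "\<exists>q > 1 / 2. y = code_rat q"
    by blast
next
  assume "\<exists>q > 1 / 2. y = code_rat q"
  then obtain q where half: "1 / 2 < q" and y: "y = code_rat q"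
    by blast
  obtain n d where nd: "quotient_of q = (n, d)"
    by fastforce
  have d: "d > 0" and q: "q = of_int n / of_int d" and nd_coprime: "coprime n d"
    using nd quotient_of_denom_pos quotient_of_div quotient_of_coprime by blast+
  have "(of_int d :: rat) < of_int (2 * n)"
    using d half by (simp add: q field_simps)
  then have "d < 2 * n"
    by (simp only: of_int_less_iff)
  moreover from this have "int_encode n = 2 * nat n"
    using d by (simp add: int_encode_def sum_encode_def)
  moreover have "coprime (nat n) (nat d)"
    using d \<open>d < 2 * n\<close> nd_coprime by (simp add: coprime_int_iff[symmetric])
  ultimately show "half_exceeding_code y"
    unfolding half_exceeding_code_def coprime_nat_iff_factors[symmetric]
    using d by (intro exI[of _ "nat n"] exI[of _ "nat d"]) (simp add: y code_rat_def nd)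
qed

definition half_exceeding_code_fm :: fm where
  "half_exceeding_code_fm = Exi (Exi (And
     (And (Eq (Var 2) (pr_tm (Mul (num 2) (Var 1)) (Var 0)))
       (And (Less Zero (Var 0)) (Less (Var 0) (Mul (num 2) (Var 1)))))
     (All (All (All (Imp (And (Eq (Var 4) (Mul (Var 2) (Var 1))) (Eq (Var 3) (Mul (Var 2) (Var 0))))
        (Eq (Var 2) (num 1))))))))"

lemma sat_half_exceeding_code_fm:
  "sat M e half_exceeding_code_fm \<longleftrightarrow> half_exceeding_code (e 0)"
  by (simp add: half_exceeding_code_fm_def half_exceeding_code_def numeral_eq_Suc)

text \<open>
  The bound variables restore the argument order of \<open>\<phi>\<close>: value, code, precision. The precision 2
  gives an error of at most \<open>1/4\<close>, which separates the values 0 and 1 at the threshold \<open>1/2\<close>.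
\<close>

definition threshold_fm :: "fm \<Rightarrow> fm" where
  "threshold_fm \<phi> = Exi (And (Eq (Var 0) (num 2))
     (Exi (And (Eq (Var 0) (Var 2)) (Exi (And \<phi> half_exceeding_code_fm)))))"

lemma threshold_fm_syntax:
  assumes "arith_fm \<phi>" "below_fm 3 \<phi>"
  shows "arith_fm (threshold_fm \<phi>)" "below_fm 1 (threshold_fm \<phi>)"
  using assms below_fm_mono[OF assms(2), of 4]
  by (simp_all add: threshold_fm_def half_exceeding_code_fm_def pr_tm_def numeral_eq_Suc)

lemma sat_threshold_fm:
  assumes "arith_fm \<phi>" "below_fm 3 \<phi>"
  shows "sat_N [x] (threshold_fm \<phi>) \<longleftrightarrow> (\<exists>q > 1 / 2. sat_N [code_rat q, x, 2] \<phi>)"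
proof -
  have "sat M (case_nat y (case_nat x (case_nat 2 (env [x])))) \<phi> \<longleftrightarrow> sat M (env [y, x, 2]) \<phi>" for M y
    by (rule sat_arith_cong[OF assms]) (auto simp: env_def less_Suc_eq numeral_3_eq_3)
  then have "sat_N [x] (threshold_fm \<phi>) \<longleftrightarrow> (\<exists>y. sat_N [y, x, 2] \<phi> \<and> half_exceeding_code y)"
    by (simp add: sat_N_def threshold_fm_def sat_half_exceeding_code_fm env_def numeral_2_eq_2)
  then show ?thesis
    by (auto simp: half_exceeding_code_iff)
qed

theorem theorem1:
  fixes fs rs :: "nat list"
  shows "\<not> (\<exists>P. gaifman_snir fs rs P \<and> arith_definable_prob fs rs P)"
proof
  assume "\<exists>P. gaifman_snir fs rs P \<and> arith_definable_prob fs rs P"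
  then obtain P g \<phi> where P: "gaifman_snir fs rs P"
    and approx: "approximates {[x] |x. x \<in> sentence_codes fs rs} g (on_codes P)"
    and g_def: "defined_by 2 {xs @ [n] |xs n. xs \<in> {[x] |x. x \<in> sentence_codes fs rs}}
      (sent_fm fs rs) g \<phi>"
    unfolding arith_definable_prob_def arith_definable_def
    by (auto simp: numeral_2_eq_2)
  have \<phi>: "arith_fm \<phi>" "below_fm 3 \<phi>"
    using g_def by (simp_all add: defined_by_def numeral_eq_Suc)
  have "sat_N [code_fm \<psi>] (threshold_fm \<phi>) \<longleftrightarrow> sat_N [] \<psi>" if \<psi>: "sentence [] [] \<psi>" for \<psi>
  proof -
    let ?q = "g [code_fm \<psi>, 2]"
    have code: "code_fm \<psi> \<in> sentence_codes fs rs"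
      using arith_sentence_lang[OF \<psi>] by (auto simp: sentence_codes_def)
    have "\<bar>on_codes P [code_fm \<psi>] - of_rat (g ([code_fm \<psi>] @ [2]))\<bar> \<le> 1 / 2 ^ 2"
      using approx code unfolding approximates_def by blast
    then have "\<bar>P \<psi> - of_rat ?q\<bar> \<le> 1 / 4"
      by (simp add: on_codes_def inv_f_f[OF inj_code_fm])
    then have "P \<psi> - of_rat ?q \<le> 1 / 4" "of_rat ?q - P \<psi> \<le> 1 / 4"
      unfolding abs_le_iff by simp_all
    moreover have "P \<psi> = (if sat_N [] \<psi> then 1 else 0)"
      by (rule gaifman_snir_arith_sentence[OF P \<psi>])
    ultimately have "(1 / 2 :: real) < of_rat ?q \<longleftrightarrow> sat_N [] \<psi>"
      by (simp split: if_splits)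
    moreover have "(1 / 2 :: real) < of_rat ?q \<longleftrightarrow> 1 / 2 < ?q"
      using of_rat_less[of "1 / 2" ?q, where ?'a = real] by (simp add: of_rat_divide)
    moreover
    have "\<exists>xs n. [code_fm \<psi>, 2] = xs @ [n] \<and> xs \<in> {[x] |x. x \<in> sentence_codes fs rs}"
      using code by (intro exI[of _ "[code_fm \<psi>]"] exI[of _ 2]) simp
    then have defined: "sat_N (code_rat q # [code_fm \<psi>, 2]) \<phi> \<longleftrightarrow> ?q = q" for q
      using g_def unfolding defined_by_def by blast
    ultimately show ?thesis
      by (simp add: sat_threshold_fm[OF \<phi>])
  qed
  then show False
    using Tarski_undefinability threshold_fm_syntax[OF \<phi>] by blast
qed

end
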